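(* Let $A(z)=\sum_{n=0}^{\infty}a_nz^n$, $B(z)=\sum_{n=0}^{\infty}b_nz^n$ and $P(z)=\sum_{n=0}^{\infty}p_nz^n$ be formal power series in one variable over $\mathbb{C}$. If the compositions $A\circ P$, $B\circ P$ and $(AB)\circ P$ all exist, then $$(A\circ P)(B\circ P)=(AB)\circ P.$$
   Context: Formal power series in one variable over $\mathbb{C}$ are identified with sequences of coefficients indexed by $\mathbb{N}_0=\{0,1,2,\ldots\}$. The product of formal power series is the Cauchy product: $(AB)_n=\sum_{j=0}^{n}a_jb_{n-j}$. Powers: $P^0:=1$ (the series with coefficients $1,0,0,\ldots$) and $P^n$ is the $n$-fold Cauchy product of $P$ with itself; $(P^n)_m$ denotes its $m$-th coefficient. The series $P$ is allowed to have nonzero constant term. Composition: $A\circ P$ is said to exist if for every $m\in\mathbb{N}_0$ the series $\sum_{n=0}^{\infty}a_n(P^n)_m$ converges in $\mathbb{C}$ (in the ordinary sense of convergence of partial sums, not necessarily absolutely); in that case $A\circ P$ is the formal power series with coefficients $(A\circ P)_m:=\sum_{n=0}^{\infty}a_n(P^n)_m$. *)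

theory Defs
  imports Complex_Main "HOL-Computational_Algebra.Formal_Power_Series"
begin

text \<open>
  Composition of formal power series where the inner series may have a nonzero constant
  term. The library's \<open>A oo P\<close> truncates the defining series of the \<open>m\<close>-th coefficient at
  \<open>n = m\<close>, which is the intended composition only if \<open>P $ 0 = 0\<close>. Here every coefficient
  is an infinite series, and convergence of its partial sums is an explicit condition.
\<close>

definition composition_exists :: "complex fps \<Rightarrow> complex fps \<Rightarrow> bool" where
  "composition_exists A P \<longleftrightarrow> (\<forall>m. summable (\<lambda>n. fps_nth A n * fps_nth (P ^ n) m))"

text \<open>Meaningful only under \<^const>\<open>composition_exists\<close>; otherwise some coefficients are unspecified.\<close>

definition composition :: "complex fps \<Rightarrow> complex fps \<Rightarrow> complex fps" where
  "composition A P = Abs_fps (\<lambda>m. \<Sum>n. fps_nth A n * fps_nth (P ^ n) m)"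

end

theory Submission
  imports Defs
begin

text \<open>
  No coefficient series need converge absolutely, so they are damped by a factor \<open>x ^ n\<close> with
  \<open>0 \<le> x < 1\<close>. For the damped series Cauchy's product theorem and \<open>P ^ i * P ^ j = P ^ (i + j)\<close>
  give the multiplication formula coefficient by coefficient, and Abel's limit theorem passes to
  \<open>x \<rightarrow> 1\<close> in each of the finitely many series involved.
\<close>

text \<open>A power series that converges at 1 converges absolutely strictly inside the unit disc.
  This supplies the absolute convergence that the Cauchy product needs, although \<open>f\<close>
  itself may converge only conditionally.\<close>

lemma summable_norm_powser_inside_1:
  fixes f :: "nat \<Rightarrow> 'a::{real_normed_field,banach}"
  assumes "summable f" "0 \<le> x" "x < 1"
  shows "summable (\<lambda>n. norm (f n * of_real x ^ n))"
  using powser_insidea[of f 1 "of_real x"] assms by simp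

text \<open>For \<open>0 < x < 1\<close> the weights \<open>(1 - x) * x ^ n\<close> are positive
  with sum 1, and each tends to 0 as \<open>x\<close> tends to 1. So any fixed finite head of
  \<open>g\<close> loses its influence, and only the small tail is averaged.\<close>

lemma abel_mean_tendsto_0:
  fixes g :: "nat \<Rightarrow> 'a::{real_normed_field,banach}"
  assumes g: "g \<longlonglongrightarrow> 0"
  shows "((\<lambda>x. (1 - of_real x) * (\<Sum>n. g n * of_real x ^ n)) \<longlongrightarrow> 0) (at_left (1::real))"
proof (rule tendstoI)
  fix e :: real
  assume "e > 0"
  then obtain N where N: "norm (g n) < e / 2" if "n \<ge> N" for n
    using LIMSEQ_D[OF g, of "e / 2"] by auto
  \<comment> \<open>\<open>M\<close> bounds the head uniformly in \<open>x\<close>, so its share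
    \<open>(1 - x) * M\<close> vanishes in the limit; the tail costs at most
    \<open>e / 2\<close>.\<close>
  define M where "M = (\<Sum>n<N. norm (g n))"
  have "((\<lambda>x. e / 2 + (1 - x) * M) \<longlongrightarrow> e / 2 + (1 - 1) * M) (at_left (1::real))"
    by (intro tendsto_intros)
  then have "\<forall>\<^sub>F x in at_left 1. e / 2 + (1 - x) * M < e"
    by (rule order_tendstoD(2)) (use \<open>e > 0\<close> in simp)
  moreover have "\<forall>\<^sub>F x in at_left (1::real). 0 < x"
    by (rule eventually_at_leftI[of 0]) auto
  moreover have "\<forall>\<^sub>F x in at_left (1::real). x < 1"
    by (simp add: eventually_at_filter)
  ultimately show "\<forall>\<^sub>F x in at_left 1.
      dist ((1 - of_real x) * (\<Sum>n. g n * of_real x ^ n)) 0 < e"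
  proof eventually_elim
    case (elim x)
    define h where "h n = (if n < N then norm (g n) else 0)" for n
    have bound: "norm (g n * of_real x ^ n) \<le> e / 2 * x ^ n + h n" for n
    proof (cases "n < N")
      case True
      then show ?thesis
        using elim \<open>e > 0\<close>
        by (auto simp: h_def norm_mult norm_power
            intro!: add_increasing mult_left_le power_le_one)
    next
      case False
      then show ?thesis
        using elim N[of n] by (simp add: h_def norm_mult norm_power mult_right_mono)
    qed
    have "(\<lambda>n. e / 2 * x ^ n) sums (e / 2 * (1 / (1 - x)))"
      using elim by (intro sums_mult geometric_sums) auto
    moreover have "h sums M"
      using sums_If_finite[of "\<lambda>n. n < N" "\<lambda>n. norm (g n)"]
      by (simp add: h_def[abs_def] M_def lessThan_def)
    ultimately have "(\<lambda>n. e / 2 * x ^ n + h n) sums (e / 2 * (1 / (1 - x)) + M)"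
      by (rule sums_add)
    then have "norm (\<Sum>n. g n * of_real x ^ n) \<le> e / 2 * (1 / (1 - x)) + M"
      using norm_suminf_le[of "\<lambda>n. g n * of_real x ^ n", OF bound] by (simp add: sums_iff)
    then have "(1 - x) * norm (\<Sum>n. g n * of_real x ^ n)
        \<le> (1 - x) * (e / 2 * (1 / (1 - x)) + M)"
      using elim by (intro mult_left_mono) auto
    also have "\<dots> = e / 2 + (1 - x) * M"
      using elim by (simp add: field_simps)
    also have "\<dots> < e"
      using elim by simp
    moreover have "norm (1 - of_real x :: 'a) = 1 - x"
      using elim norm_of_real[of "1 - x", where 'a = 'a] by simp
    ultimately show ?case
      by (simp add: norm_mult)
  qed
qed

text \<open>Summation by parts turns the distance between the damped sum and \<open>suminf f\<close>
  into the Abel mean of the errors of the partial sums, a null sequence.\<close>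

theorem abel_limit_at_left_1:
  fixes f :: "nat \<Rightarrow> 'a::{real_normed_field,banach}"
  assumes "summable f"
  shows "((\<lambda>x. \<Sum>n. f n * of_real x ^ n) \<longlongrightarrow> suminf f) (at_left (1::real))"
proof -
  define t where "t n = (\<Sum>k\<le>n. f k) - suminf f" for n
  have t: "t \<longlonglongrightarrow> 0"
    using summable_LIMSEQ'[OF assms] unfolding t_def[abs_def] by (rule LIM_zero)
  have by_parts: "(1 - of_real x) * (\<Sum>n. t n * of_real x ^ n)
      = (\<Sum>n. f n * of_real x ^ n) - suminf f"
    if x: "0 < x" "x < 1" for x :: real
  proof -
    let ?x = "of_real x :: 'a"
    \<comment> \<open>Boundedness of \<open>t\<close> yields a geometric majorant, hence the
      convergence needed to rearrange the series below.\<close>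
    have "Bseq t"
      using t by (intro convergent_imp_Bseq convergentI)
    then obtain K where K: "norm (t n) \<le> K" for n
      by (auto simp: Bseq_def)
    have sum_t: "summable (\<lambda>n. t n * ?x ^ n)"
    proof (rule summable_comparison_test')
      show "summable (\<lambda>n. K * x ^ n)"
        using x by (intro summable_mult summable_geometric) auto
      show "norm (t n * ?x ^ n) \<le> K * x ^ n" for n
        using x K[of n] by (simp add: norm_mult norm_power mult_right_mono)
    qed
    have sum_f: "summable (\<lambda>n. f n * ?x ^ n)"
      using summable_norm_powser_inside_1[OF assms] x by (simp add: summable_norm_cancel)
    have t_Suc: "t (Suc n) - t n = f (Suc n)" for n
      by (simp add: t_def)
    have "(1 - ?x) * (\<Sum>n. t n * ?x ^ n)
        = (\<Sum>n. t n * ?x ^ n) - (\<Sum>n. t n * ?x ^ Suc n)"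
      using suminf_mult[OF sum_t, of ?x] by (simp add: algebra_simps)
    also have "\<dots> = t 0 + (\<Sum>n. t (Suc n) * ?x ^ Suc n) - (\<Sum>n. t n * ?x ^ Suc n)"
      using suminf_split_head[OF sum_t] by simp
    also have "\<dots>
        = t 0 + (\<Sum>n. t (Suc n) * ?x ^ Suc n - t n * ?x ^ Suc n)"
    proof -
      have "summable (\<lambda>n. t (Suc n) * ?x ^ Suc n)"
        using sum_t summable_Suc_iff[of "\<lambda>n. t n * ?x ^ n"] by simp
      moreover have "summable (\<lambda>n. t n * ?x ^ Suc n)"
        using summable_mult[OF sum_t, of ?x] by (simp add: mult_ac)
      ultimately show ?thesis
        by (simp add: suminf_diff)
    qed
    also have "\<dots> = t 0 + (\<Sum>n. f (Suc n) * ?x ^ Suc n)"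
      by (simp only: left_diff_distrib[symmetric] t_Suc)
    \<comment> \<open>Since \<open>t 0 = f 0 - suminf f\<close>, the leading term provides both the
      missing zeroth summand and the constant.\<close>
    also have "\<dots> = (\<Sum>n. f n * ?x ^ n) - suminf f"
      using suminf_split_head[OF sum_f] by (simp add: t_def)
    finally show ?thesis .
  qed
  have "\<forall>\<^sub>F x in at_left (1::real). 0 < x \<and> x < 1"
    by (rule eventually_at_leftI[of 0]) auto
  then have "\<forall>\<^sub>F x in at_left 1. (1 - of_real x) * (\<Sum>n. t n * of_real x ^ n)
      = (\<Sum>n. f n * of_real x ^ n) - suminf f"
    by eventually_elim (simp add: by_parts)
  from Lim_transform_eventually[OF abel_mean_tendsto_0[OF t] this]
  show ?thesis
    by (rule LIM_zero_cancel)
qed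

theorem theorem17:
  fixes A B P :: "complex fps"
  assumes "composition_exists A P"
    and "composition_exists B P"
    and "composition_exists (A * B) P"
  shows "composition A P * composition B P = composition (A * B) P"
proof (rule fps_ext)
  fix m
  define summand where "summand F i n = fps_nth F n * fps_nth (P ^ n) i" for F i n
  define damped where "damped F i x = (\<Sum>n. summand F i n * of_real x ^ n)" for F i and x :: real
  have summable_summand: "summable (summand F i)" if "composition_exists F P" for F i
    using that by (simp add: composition_exists_def summand_def[abs_def])
  have composition_nth: "fps_nth (composition F P) i = suminf (summand F i)" for F i
    by (simp add: composition_def summand_def[abs_def])
  have limit: "(damped F i \<longlongrightarrow> fps_nth (composition F P) i) (at_left 1)"
    if "composition_exists F P" for F i
    unfolding damped_def[abs_def] composition_nth
    by (rule abel_limit_at_left_1[OF summable_summand[OF that]])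

  \<comment> \<open>With the sums interchanged, the sum over \<open>i\<close> is the
    \<open>m\<close>-th coefficient of \<open>P ^ k * P ^ (n - k) = P ^ n\<close>, which is
    independent of \<open>k\<close>; what remains is the \<open>n\<close>-th coefficient of
    \<open>A * B\<close>.\<close>
  have convolution: "(\<Sum>i=0..m. \<Sum>k\<le>n. summand A i k * summand B (m - i) (n - k)) = summand (A * B) m n"
    for n
  proof -
    have "(\<Sum>i=0..m. \<Sum>k\<le>n. summand A i k * summand B (m - i) (n - k))
        = (\<Sum>k\<le>n. fps_nth A k * fps_nth B (n - k)
            * (\<Sum>i=0..m. fps_nth (P ^ k) i * fps_nth (P ^ (n - k)) (m - i)))"
      by (subst sum.swap) (simp add: summand_def sum_distrib_left mult_ac)
    also have "\<dots> = (\<Sum>k\<le>n. fps_nth A k * fps_nth B (n - k) * fps_nth (P ^ n) m)"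
      by (intro sum.cong refl)
        (simp only: fps_mult_nth[symmetric] power_add[symmetric] atMost_iff le_add_diff_inverse)
    also have "\<dots> = summand (A * B) m n"
      by (simp add: summand_def fps_mult_nth sum_distrib_right atLeast0AtMost)
    finally show ?thesis .
  qed
  have damped_mult: "(\<Sum>i=0..m. damped A i x * damped B (m - i) x) = damped (A * B) m x"
    if x: "0 < x" "x < 1" for x
  proof -
    have "(\<lambda>n. \<Sum>k\<le>n. summand A i k * of_real x ^ k * (summand B (m - i) (n - k) * of_real x ^ (n - k)))
        sums (damped A i x * damped B (m - i) x)" for i
      unfolding damped_def using assms(1,2) x
      by (intro Cauchy_product_sums[of "\<lambda>k. summand A i k * of_real x ^ k"
              "\<lambda>l. summand B (m - i) l * of_real x ^ l"]
            summable_norm_powser_inside_1 summable_summand) simp_all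
    \<comment> \<open>The damping is multiplicative: the exponents \<open>k\<close> and
      \<open>n - k\<close> add up to \<open>n\<close> because \<open>k \<le> n\<close>, so one
      common factor comes out of each convolution.\<close>
    moreover have "(\<Sum>k\<le>n. summand A i k * of_real x ^ k * (summand B (m - i) (n - k) * of_real x ^ (n - k)))
        = (\<Sum>k\<le>n. summand A i k * summand B (m - i) (n - k)) * of_real x ^ n" for i n
      unfolding sum_distrib_right
    proof (intro sum.cong refl)
      fix k assume "k \<in> {..n}"
      then have "(of_real x :: complex) ^ n = of_real x ^ k * of_real x ^ (n - k)"
        by (simp add: power_add[symmetric])
      then show "summand A i k * of_real x ^ k * (summand B (m - i) (n - k) * of_real x ^ (n - k))
          = summand A i k * summand B (m - i) (n - k) * of_real x ^ n"
        by (simp add: mult_ac)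
    qed
    ultimately have "(\<lambda>n. \<Sum>i=0..m. (\<Sum>k\<le>n. summand A i k * summand B (m - i) (n - k)) * of_real x ^ n)
        sums (\<Sum>i=0..m. damped A i x * damped B (m - i) x)"
      by (intro sums_sum) (simp only:)
    then have "(\<lambda>n. summand (A * B) m n * of_real x ^ n)
        sums (\<Sum>i=0..m. damped A i x * damped B (m - i) x)"
      by (simp only: sum_distrib_right[symmetric] convolution)
    then show ?thesis
      by (simp add: damped_def sums_iff)
  qed

  have "((\<lambda>x. \<Sum>i=0..m. damped A i x * damped B (m - i) x)
      \<longlongrightarrow> fps_nth (composition A P * composition B P) m) (at_left 1)"
    unfolding fps_mult_nth by (intro tendsto_intros limit assms)
  moreover have "\<forall>\<^sub>F x in at_left (1::real). 0 < x \<and> x < 1"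
    by (rule eventually_at_leftI[of 0]) auto
  then have "\<forall>\<^sub>F x in at_left 1.
      (\<Sum>i=0..m. damped A i x * damped B (m - i) x) = damped (A * B) m x"
    by eventually_elim (simp add: damped_mult)
  ultimately have "(damped (A * B) m
      \<longlongrightarrow> fps_nth (composition A P * composition B P) m) (at_left 1)"
    by (rule Lim_transform_eventually)
  \<comment> \<open>The existence of the composition for \<open>A * B\<close> enters here: Abel's
    theorem gives the same damped function a second limit, and limits along the nontrivial filter
    \<open>at_left 1\<close> are unique.\<close>
  then show "fps_nth (composition A P * composition B P) m
      = fps_nth (composition (A * B) P) m"
    using limit[OF assms(3)] by (rule tendsto_unique[rotated]) simp
qed

end
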